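(* Let $G$ be a countable amenable group and let $A,B\subseteq G$ be such that $d^*(A)>0$ and $d^*(B)>0$. Then the product set $AB=\{ab : a\in A,\ b\in B\}$ is piecewise syndetic.
   Context: $G$ is a countable discrete group. A sequence $(F_n)_{n\in\mathbb{N}}$ of (nonempty) finite subsets of $G$ is a (left) Følner sequence if $\lim_{n\to\infty} |gF_n\bigtriangleup F_n|/|F_n|=0$ for every $g\in G$; $G$ is amenable if it admits a Følner sequence. For $A\subseteq G$ put $\overline d_{(F_n)}(A)=\limsup_{n\to\infty}|A\cap F_n|/|F_n|$, and define the upper Banach density $d^*(A)=\sup\{\overline d_{(F_n)}(A): (F_n)_{n\in\mathbb{N}}\text{ is a (left) Følner sequence in }G\}$. A set $S\subseteq G$ is syndetic if there is a finite set $F\subseteq G$ with $FS=G$. A set $T\subseteq G$ is thick if for each finite set $F\subseteq G$ there is $t\in G$ with $Ft\subseteq T$. A set $C\subseteq G$ is piecewise syndetic if there exist a thick set $T$ and a syndetic set $S$ such that $C\supseteq S\cap T$. *)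

theory Defs
  imports "HOL-Algebra.Coset" "HOL-Library.Countable_Set" "HOL-Library.Liminf_Limsup"
    "HOL-Library.Extended_Real"
begin

definition folner_sequence :: "('a, 'b) monoid_scheme \<Rightarrow> (nat \<Rightarrow> 'a set) \<Rightarrow> bool" where
  "folner_sequence G F \<longleftrightarrow>
     (\<forall>n. finite (F n) \<and> F n \<noteq> {} \<and> F n \<subseteq> carrier G) \<and>
     (\<forall>g \<in> carrier G.
        (\<lambda>n. real (card (sym_diff (g <#\<^bsub>G\<^esub> F n) (F n))) / real (card (F n))) \<longlonglongrightarrow> 0)"

definition amenable :: "('a, 'b) monoid_scheme \<Rightarrow> bool" where
  "amenable G \<longleftrightarrow> (\<exists>F. folner_sequence G F)"

text \<open>Densities are taken in \<^typ>\<open>ereal\<close>, where limsup and supremum always exist. For a Folner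
  sequence the ratios lie in the unit interval, so in an amenable group both densities are
  finite and agree with the real-valued ones.\<close>

definition upper_density :: "(nat \<Rightarrow> 'a set) \<Rightarrow> 'a set \<Rightarrow> ereal" where
  "upper_density F A = limsup (\<lambda>n. ereal (real (card (A \<inter> F n)) / real (card (F n))))"

definition upper_banach_density :: "('a, 'b) monoid_scheme \<Rightarrow> 'a set \<Rightarrow> ereal" where
  "upper_banach_density G A = Sup {upper_density F A |F. folner_sequence G F}"

definition syndetic :: "('a, 'b) monoid_scheme \<Rightarrow> 'a set \<Rightarrow> bool" where
  "syndetic G S \<longleftrightarrow> S \<subseteq> carrier G \<and>
     (\<exists>F. finite F \<and> F \<subseteq> carrier G \<and> F <#>\<^bsub>G\<^esub> S = carrier G)"

definition thick :: "('a, 'b) monoid_scheme \<Rightarrow> 'a set \<Rightarrow> bool" where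
  "thick G T \<longleftrightarrow> T \<subseteq> carrier G \<and>
     (\<forall>F. finite F \<and> F \<subseteq> carrier G \<longrightarrow> (\<exists>t \<in> carrier G. F #>\<^bsub>G\<^esub> t \<subseteq> T))"

definition piecewise_syndetic :: "('a, 'b) monoid_scheme \<Rightarrow> 'a set \<Rightarrow> bool" where
  "piecewise_syndetic G C \<longleftrightarrow> C \<subseteq> carrier G \<and>
     (\<exists>T S. thick G T \<and> syndetic G S \<and> S \<inter> T \<subseteq> C)"

end

theory Submission
  imports Defs
begin

text \<open>
  The argument is elementary: it uses double counting over Folner sets and no invariant means.
  Call \<open>D\<close> \<open>c\<close>-translate-dense if every nonempty finite set \<open>H\<close> has a right translate \<open>Ht\<close>
  of which \<open>D\<close> fills more than the proportion \<open>c\<close>. Since right translation preserves left Folner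
  sequences, this is a lower bound on upper Banach density that does not mention such sequences.

  The counting identity is \<open>\<Sum>t\<in>X. |D \<inter> Ht| = \<Sum>h\<in>H. |D \<inter> hX|\<close>. If \<open>X\<close> is almost invariant, the
  right-hand side is about \<open>|H| |D \<inter> X|\<close>. On the left, only the \<open>t\<close> in \<open>H\<inverse>D\<close> contribute. Hence
  some \<open>Ht\<close> is filled by \<open>D\<close> to a proportion of about \<open>|D \<inter> X| / |H\<inverse>D \<inter> X|\<close>
  (\<open>exists_dense_translate\<close>).

  For \<open>B\<close>, bounding \<open>|H\<inverse>B \<inter> X|\<close> by \<open>|X|\<close> shows that \<open>B\<close> is \<open>b\<close>-translate-dense for every
  \<open>b < d\<^sup>*(B)\<close>. For \<open>A\<close>, let \<open>\<gamma>\<close> be the supremum of \<open>d\<^sup>*(KA)\<close> over finite \<open>K\<close> and choose \<open>K\<close> with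
  \<open>d\<^sup>*(KA)\<close> close to \<open>\<gamma>\<close>. The set \<open>H\<inverse>KA\<close> is again a finite union of translates of \<open>A\<close>, so its
  density is at most \<open>\<gamma>\<close>, the quotient above is close to 1, and \<open>D = KA\<close> is \<open>c\<close>-translate-dense
  with \<open>c\<close> as close to 1 as desired (\<open>translate_dense_finite_translates\<close>).

  Once \<open>c + b > 1\<close>, the set \<open>DB\<close> is thick (\<open>thick_set_mult\<close>): in a suitable almost invariant set
  \<open>X\<close>, the points \<open>x\<close> with \<open>fx \<in> D\<close> and those with \<open>x\<inverse>t \<in> B\<close> are too many to be disjoint,
  and a common point gives \<open>ft = (fx)(x\<inverse>t) \<in> DB\<close>. So \<open>K(AB)\<close> is thick, which makes \<open>AB\<close>
  piecewise syndetic.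
\<close>

section \<open>Double counting over almost invariant sets\<close>

text \<open>The set \<open>H\<close> has to be nonempty because the strict inequality fails for the empty set.\<close>

definition translate_dense :: "('a, 'b) monoid_scheme \<Rightarrow> real \<Rightarrow> 'a set \<Rightarrow> bool" where
  "translate_dense G c D \<longleftrightarrow>
     (\<forall>H. finite H \<and> H \<noteq> {} \<and> H \<subseteq> carrier G \<longrightarrow>
        (\<exists>t \<in> carrier G. c * real (card H) < real (card (D \<inter> (H #>\<^bsub>G\<^esub> t)))))"

lemma card_Int_le_add_sym_diff:
  assumes "finite X" "finite Y"
  shows "card (D \<inter> X) \<le> card (D \<inter> Y) + card (sym_diff X Y)"
proof -
  have "card (D \<inter> X) \<le> card ((D \<inter> Y) \<union> sym_diff X Y)"
    using assms by (intro card_mono) auto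
  also have "\<dots> \<le> card (D \<inter> Y) + card (sym_diff X Y)"
    by (rule card_Un_le)
  finally show ?thesis .
qed

lemma (in group) card_Int_l_coset:
  assumes "h \<in> carrier G" "X \<subseteq> carrier G"
  shows "card (D \<inter> (h <# X)) = card {x \<in> X. h \<otimes> x \<in> D}"
proof -
  have "D \<inter> (h <# X) = (\<lambda>x. h \<otimes> x) ` {x \<in> X. h \<otimes> x \<in> D}"
    by (auto simp: l_coset_def)
  moreover have "inj_on (\<lambda>x. h \<otimes> x) {x \<in> X. h \<otimes> x \<in> D}"
    using assms by (auto simp: inj_on_def subset_iff)
  ultimately show ?thesis by (simp add: card_image)
qed

lemma (in group) card_Int_r_coset:
  assumes "t \<in> carrier G" "H \<subseteq> carrier G"
  shows "card (D \<inter> (H #> t)) = card {h \<in> H. h \<otimes> t \<in> D}"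
proof -
  have "D \<inter> (H #> t) = (\<lambda>h. h \<otimes> t) ` {h \<in> H. h \<otimes> t \<in> D}"
    by (auto simp: r_coset_def)
  moreover have "inj_on (\<lambda>h. h \<otimes> t) {h \<in> H. h \<otimes> t \<in> D}"
    using assms by (auto simp: inj_on_def subset_iff)
  ultimately show ?thesis by (simp add: card_image)
qed

lemma (in group) sum_card_translates:
  assumes "finite H" "finite X" "H \<subseteq> carrier G" "X \<subseteq> carrier G"
  shows "(\<Sum>t\<in>X. card (D \<inter> (H #> t))) = (\<Sum>h\<in>H. card (D \<inter> (h <# X)))"
proof -
  have "(\<Sum>t\<in>X. card (D \<inter> (H #> t))) = (\<Sum>t\<in>X. card {h \<in> H. h \<otimes> t \<in> D})"
    using assms(3,4) by (intro sum.cong refl card_Int_r_coset) auto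
  also have "\<dots> = (\<Sum>h\<in>H. card {t \<in> X. h \<otimes> t \<in> D})"
    using assms(2,1) by (rule sum_multicount_gen) simp
  also have "\<dots> = (\<Sum>h\<in>H. card (D \<inter> (h <# X)))"
    using assms(3,4) by (intro sum.cong refl card_Int_l_coset[symmetric]) auto
  finally show ?thesis .
qed

text \<open>The sum over \<open>t \<in> X\<close> of \<open>|D \<inter> Ht|\<close> is at least \<open>(a - e) |H| |X|\<close> by the counting identity,
  and at most \<open>q |X|\<close> of its terms are nonzero; if each of those were at most \<open>c |H|\<close>, then
  \<open>a - e \<le> c q\<close>.\<close>

lemma (in group) exists_dense_translate_in_invariant_set:
  fixes a c e q :: real
  assumes H: "finite H" "H \<noteq> {}" "H \<subseteq> carrier G"
    and X: "finite X" "X \<noteq> {}" "X \<subseteq> carrier G"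
    and inv: "\<And>h. h \<in> H \<Longrightarrow> real (card (sym_diff (h <# X) X)) \<le> e * real (card X)"
    and dense: "a * real (card X) \<le> real (card (D \<inter> X))"
    and sparse: "real (card {t \<in> X. D \<inter> (H #> t) \<noteq> {}}) \<le> q * real (card X)"
    and c: "0 \<le> c" "c * q < a - e"
  shows "\<exists>t\<in>X. c * real (card H) < real (card (D \<inter> (H #> t)))"
proof (rule ccontr)
  assume "\<not> ?thesis"
  then have small: "real (card (D \<inter> (H #> t))) \<le> c * real (card H)" if "t \<in> X" for t
    using that by force
  define Q where "Q = {t \<in> X. D \<inter> (H #> t) \<noteq> {}}"
  have pos: "0 < real (card H)" "0 < real (card X)"
    using H X by (auto simp: card_gt_0_iff)
  have each: "(a - e) * real (card X) \<le> real (card (D \<inter> (h <# X)))" if "h \<in> H" for h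
  proof -
    have fin: "finite (h <# X)"
      using X by (simp add: l_coset_def)
    have "card (D \<inter> X) \<le> card (D \<inter> (h <# X)) + card (sym_diff X (h <# X))"
      by (rule card_Int_le_add_sym_diff[OF X(1) fin])
    moreover have "sym_diff X (h <# X) = sym_diff (h <# X) X"
      by auto
    ultimately show ?thesis
      using inv[OF that] dense by (simp add: left_diff_distrib)
  qed
  have "real (card H) * ((a - e) * real (card X)) \<le> (\<Sum>h\<in>H. real (card (D \<inter> (h <# X))))"
    using sum_mono[of H "\<lambda>_. (a - e) * real (card X)"] each by simp
  also have "\<dots> = (\<Sum>t\<in>X. real (card (D \<inter> (H #> t))))"
    using sum_card_translates[OF H(1) X(1) H(3) X(3), of D] by (simp flip: of_nat_sum)
  also have "\<dots> = (\<Sum>t\<in>Q. real (card (D \<inter> (H #> t))))"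
    using X by (intro sum.mono_neutral_right) (auto simp: Q_def)
  also have "\<dots> \<le> (\<Sum>t\<in>Q. c * real (card H))"
    by (intro sum_mono small) (auto simp: Q_def)
  also have "\<dots> = (c * real (card H)) * real (card Q)"
    by simp
  also have "\<dots> \<le> (c * real (card H)) * (q * real (card X))"
    using sparse c by (intro mult_left_mono) (auto simp: Q_def)
  finally have "(a - e) * (real (card H) * real (card X)) \<le> (c * q) * (real (card H) * real (card X))"
    by (simp add: mult_ac)
  then show False
    using c(2) pos by (simp add: mult_le_cancel_right)
qed

section \<open>Densities along Folner sequences\<close>

lemma folner_sequenceD:
  assumes "folner_sequence G F"
  shows "finite (F n)" "F n \<noteq> {}" "F n \<subseteq> carrier G"
  using assms unfolding folner_sequence_def by blast+

lemma folner_sequence_eventually_invariant: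
  assumes F: "folner_sequence G F" and H: "finite H" "H \<subseteq> carrier G" and e: "0 < e"
  shows "\<forall>\<^sub>F n in sequentially. \<forall>h\<in>H.
           real (card (sym_diff (h <#\<^bsub>G\<^esub> F n) (F n))) \<le> e * real (card (F n))"
proof (intro eventually_ball_finite ballI H(1))
  fix h assume "h \<in> H"
  then have "(\<lambda>n. real (card (sym_diff (h <#\<^bsub>G\<^esub> F n) (F n))) / real (card (F n))) \<longlonglongrightarrow> 0"
    using F H unfolding folner_sequence_def by blast
  then have "\<forall>\<^sub>F n in sequentially.
      real (card (sym_diff (h <#\<^bsub>G\<^esub> F n) (F n))) / real (card (F n)) < e"
    using e by (rule order_tendstoD)
  then show "\<forall>\<^sub>F n in sequentially.
      real (card (sym_diff (h <#\<^bsub>G\<^esub> F n) (F n))) \<le> e * real (card (F n))"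
  proof eventually_elim
    case (elim n)
    have "0 < real (card (F n))"
      using folner_sequenceD[OF F, of n] by (simp add: card_gt_0_iff)
    then show ?case using elim by (simp add: divide_less_eq)
  qed
qed

lemma upper_density_le_one:
  assumes "folner_sequence G F"
  shows "upper_density F A \<le> 1"
  unfolding upper_density_def
proof (intro Limsup_bounded always_eventually allI)
  fix n
  have "card (A \<inter> F n) \<le> card (F n)"
    using folner_sequenceD[OF assms, of n] by (intro card_mono) auto
  then show "ereal (real (card (A \<inter> F n)) / real (card (F n))) \<le> 1"
    by (simp add: divide_le_eq)
qed

lemma upper_density_le_banach:
  "folner_sequence G F \<Longrightarrow> upper_density F A \<le> upper_banach_density G A"
  unfolding upper_banach_density_def by (intro Sup_upper) auto

lemma upper_banach_density_le_one: "upper_banach_density G A \<le> 1"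
  unfolding upper_banach_density_def by (intro Sup_least) (auto intro: upper_density_le_one)

section \<open>Sets that nearly fill translates of finite sets\<close>

text \<open>This is the finite counting argument applied to one member of a Folner sequence. The two
  density hypotheses combine because \<open>D\<close> is dense in infinitely many members of the sequence,
  while \<open>H\<inverse>D\<close> is sparse, and invariance good, in all but finitely many.\<close>

lemma (in group) exists_dense_translate:
  fixes a c q :: real
  assumes F: "folner_sequence G F"
    and H: "finite H" "H \<noteq> {}" "H \<subseteq> carrier G"
    and D: "D \<subseteq> carrier G"
    and dense: "ereal a < upper_density F D"
    and sparse: "upper_density F (set_inv H <#> D) < ereal q"
    and c: "0 \<le> c" "c * q < a"
  shows "\<exists>t\<in>carrier G. c * real (card H) < real (card (D \<inter> (H #> t)))"
proof -
  define e where "e = (a - c * q) / 2"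
  have e: "0 < e" "c * q < a - e"
    using c by (auto simp: e_def field_simps)
  have "\<forall>\<^sub>F n in sequentially.
      ereal (real (card ((set_inv H <#> D) \<inter> F n)) / real (card (F n))) < ereal q"
    using sparse unfolding upper_density_def by (rule Limsup_lessD)
  with folner_sequence_eventually_invariant[OF F H(1,3) e(1)]
  have good: "\<forall>\<^sub>F n in sequentially.
      (\<forall>h\<in>H. real (card (sym_diff (h <# F n) (F n))) \<le> e * real (card (F n))) \<and>
      ereal (real (card ((set_inv H <#> D) \<inter> F n)) / real (card (F n))) < ereal q"
    by (rule eventually_conj)
  have "\<exists>n. ((\<forall>h\<in>H. real (card (sym_diff (h <# F n) (F n))) \<le> e * real (card (F n))) \<and>
      ereal (real (card ((set_inv H <#> D) \<inter> F n)) / real (card (F n))) < ereal q) \<and>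
      \<not> ereal (real (card (D \<inter> F n)) / real (card (F n))) \<le> ereal a"
  proof (rule ccontr)
    assume none: "\<not> ?thesis"
    have "\<forall>\<^sub>F n in sequentially. ereal (real (card (D \<inter> F n)) / real (card (F n))) \<le> ereal a"
      using none by (intro eventually_mono[OF good]) blast
    then have "upper_density F D \<le> ereal a"
      unfolding upper_density_def by (rule Limsup_bounded)
    with dense show False by simp
  qed
  then obtain n where
    n: "a < real (card (D \<inter> F n)) / real (card (F n))"
       "real (card ((set_inv H <#> D) \<inter> F n)) / real (card (F n)) < q"
       "\<And>h. h \<in> H \<Longrightarrow> real (card (sym_diff (h <# F n) (F n))) \<le> e * real (card (F n))"
    by (metis ereal_less_eq(3) less_ereal.simps(1) not_le)
  note X = folner_sequenceD[OF F, of n]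
  have pos: "0 < real (card (F n))"
    using X by (simp add: card_gt_0_iff)
  \<comment> \<open>A translate \<open>Ht\<close> can meet \<open>D\<close> only if \<open>t\<close> lies in \<open>H\<inverse>D\<close>.\<close>
  have "{t \<in> F n. D \<inter> (H #> t) \<noteq> {}} \<subseteq> (set_inv H <#> D) \<inter> F n"
  proof
    fix t assume "t \<in> {t \<in> F n. D \<inter> (H #> t) \<noteq> {}}"
    then obtain h x where t: "t \<in> F n" and x: "x \<in> D" and h: "h \<in> H" "x = h \<otimes> t"
      by (auto simp: r_coset_def)
    have "t = inv h \<otimes> x"
      using h t H X by (auto simp: subset_iff m_assoc[symmetric])
    then show "t \<in> (set_inv H <#> D) \<inter> F n"
      using h(1) t x unfolding set_mult_def SET_INV_def by blast
  qed
  then have "card {t \<in> F n. D \<inter> (H #> t) \<noteq> {}} \<le> card ((set_inv H <#> D) \<inter> F n)"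
    using X by (intro card_mono) auto
  then have "\<exists>t\<in>F n. c * real (card H) < real (card (D \<inter> (H #> t)))"
    using n pos
    by (intro exists_dense_translate_in_invariant_set[OF H X n(3) _ _ c(1) e(2)])
       (auto simp: field_simps)
  then show ?thesis using X by blast
qed

text \<open>Here \<open>H\<inverse>B\<close> is only known to have density at most 1. The bound \<open>q\<close> on that density must be
  strict, so it is taken slightly above 1, using the slack between \<open>b\<close> and \<open>d\<^sup>*(B)\<close>.\<close>

lemma (in group) translate_dense_of_upper_banach_density:
  assumes B: "B \<subseteq> carrier G" and b: "0 \<le> b" "ereal b < upper_banach_density G B"
  shows "translate_dense G b B"
  unfolding translate_dense_def
proof (intro allI impI)
  fix H assume H: "finite H \<and> H \<noteq> {} \<and> H \<subseteq> carrier G"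
  obtain F where F: "folner_sequence G F" "ereal b < upper_density F B"
    using b unfolding upper_banach_density_def less_Sup_iff by auto
  obtain a where a: "ereal b < ereal a" "ereal a < upper_density F B"
    using F(2) by (metis ereal_dense2 ereal_less_eq(3) less_ereal.simps(1) order.strict_trans2)
  define q where "q = 1 + (a - b) / 2"
  have q: "1 < q" using a by (simp add: q_def)
  have "a < 1"
    using a(2) upper_density_le_one[OF F(1), of B] by (metis ereal_less(3) less_le_trans)
  then have "b * q < a"
  proof -
    have "b * ((a - b) / 2) \<le> 1 * ((a - b) / 2)"
      using a \<open>a < 1\<close> by (intro mult_right_mono) auto
    moreover have "b * q = b + b * ((a - b) / 2)"
      by (simp add: q_def distrib_left)
    moreover have "b < a" using a by simp
    ultimately show ?thesis by argo
  qed
  then show "\<exists>t\<in>carrier G. b * real (card H) < real (card (B \<inter> (H #> t)))"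
    using H q upper_density_le_one[OF F(1), of "set_inv H <#> B"]
    by (intro exists_dense_translate[OF F(1) _ _ _ B a(2) _ b(1), of H q])
       (auto intro: le_less_trans)
qed


text \<open>A near-maximal density among the sets \<open>KA\<close> forces near-invariance: passing from \<open>KA\<close> to
  \<open>H\<inverse>KA\<close> can hardly increase the density, so wherever a translate \<open>Ht\<close> meets \<open>KA\<close> it lies, on
  average, almost entirely inside \<open>KA\<close>.\<close>

lemma (in group) translate_dense_finite_translates:
  assumes A: "A \<subseteq> carrier G" and pos: "0 < upper_banach_density G A"
    and c: "0 \<le> c" "c < 1"
  shows "\<exists>K. finite K \<and> K \<subseteq> carrier G \<and> translate_dense G c (K <#> A)"
proof -
  define g where "g = (SUP K\<in>{K. finite K \<and> K \<subseteq> carrier G}. upper_banach_density G (K <#> A))"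
  have g_upper: "upper_banach_density G (K <#> A) \<le> g" if "finite K" "K \<subseteq> carrier G" for K
    unfolding g_def using that by (intro SUP_upper) auto
  have "{\<one>} <#> A = A"
    using A by (auto simp: set_mult_def subset_iff)
  then have "0 < g"
    using g_upper[of "{\<one>}"] pos by (auto intro: less_le_trans)
  moreover have "g \<le> 1"
    unfolding g_def by (intro SUP_least upper_banach_density_le_one)
  ultimately obtain r where r: "g = ereal r" "0 < r"
    by (cases g) auto
  \<comment> \<open>The densities \<open>a < g < q\<close> are so close to each other that \<open>c < a / q\<close>.\<close>
  define d where "d = (1 - c) / 4"
  define a where "a = r * (1 - d)"
  define q where "q = r * (1 + d)"
  have d: "0 < d" "c * (1 + d) < 1 - d"
  proof -
    show "0 < d" using c by (simp add: d_def)
    then have "c * d \<le> 1 * d"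
      using c by (intro mult_right_mono) auto
    moreover have "c + 2 * d < 1"
      using c by (simp add: d_def field_simps)
    ultimately show "c * (1 + d) < 1 - d"
      by (simp add: distrib_left)
  qed
  have cq: "c * q < a"
    using mult_strict_left_mono[OF d(2) r(2)] by (simp add: a_def q_def mult_ac)
  have "ereal a < g" "g < ereal q"
    using r d by (simp_all add: a_def q_def)
  then obtain K where K: "finite K" "K \<subseteq> carrier G" "ereal a < upper_banach_density G (K <#> A)"
    unfolding g_def less_SUP_iff by auto
  then obtain F where F: "folner_sequence G F" "ereal a < upper_density F (K <#> A)"
    unfolding upper_banach_density_def less_Sup_iff by auto
  have KA: "K <#> A \<subseteq> carrier G"
    using K A by (intro set_mult_closed)
  have "translate_dense G c (K <#> A)"
    unfolding translate_dense_def
  proof (intro allI impI)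
    fix H assume H: "finite H \<and> H \<noteq> {} \<and> H \<subseteq> carrier G"
    then have HK: "finite (set_inv H <#> K)" "set_inv H <#> K \<subseteq> carrier G" "set_inv H \<subseteq> carrier G"
      using K by (auto simp: set_mult_def SET_INV_def subset_iff)
    have "upper_density F (set_inv H <#> (K <#> A)) \<le> upper_banach_density G ((set_inv H <#> K) <#> A)"
      using upper_density_le_banach[OF F(1)] set_mult_assoc[OF HK(3) K(2) A] by simp
    also have "\<dots> \<le> g"
      by (rule g_upper[OF HK(1,2)])
    finally have "upper_density F (set_inv H <#> (K <#> A)) < ereal q"
      using \<open>g < ereal q\<close> by (rule le_less_trans)
    then show "\<exists>t\<in>carrier G. c * real (card H) < real (card ((K <#> A) \<inter> (H #> t)))"
      using H by (intro exists_dense_translate[OF F(1) _ _ _ KA F(2) _ c(1) cq]) auto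
  qed
  then show ?thesis using K by blast
qed

section \<open>Thickness of products and piecewise syndeticity\<close>

text \<open>Given finite \<open>K\<close>, a Folner set \<open>F\<^sub>n\<close> almost invariant under \<open>K\<close> has a right translate \<open>X\<close>
  filled by \<open>D\<close> beyond \<open>c\<close>, and right translation keeps the invariance. Applying the density of \<open>B\<close>
  to \<open>X\<inverse>\<close> yields one \<open>t\<close> for which more than \<open>b |X|\<close> elements \<open>x\<close> of \<open>X\<close> satisfy
  \<open>x\<inverse>t \<in> B\<close>; this \<open>t\<close> does not depend on \<open>f \<in> K\<close>, and the pigeonhole principle then works for
  each \<open>f\<close> separately.\<close>

lemma (in group) thick_set_mult:
  assumes am: "amenable G" and D: "D \<subseteq> carrier G" and B: "B \<subseteq> carrier G"
    and Dd: "translate_dense G c D" and Bd: "translate_dense G b B" and cb: "1 < c + b"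
  shows "thick G (D <#> B)"
  unfolding thick_def
proof (intro conjI allI impI)
  show "D <#> B \<subseteq> carrier G"
    using D B by (rule set_mult_closed)
next
  fix K assume K: "finite K \<and> K \<subseteq> carrier G"
  obtain F where F: "folner_sequence G F"
    using am by (auto simp: amenable_def)
  \<comment> \<open>The excess \<open>c + b - 1\<close> is the proportion of \<open>X\<close> that translating by \<open>f\<close> may lose.\<close>
  define e where "e = c + b - 1"
  have "0 < e" using cb by (simp add: e_def)
  then have "\<exists>n. \<forall>f\<in>K. real (card (sym_diff (f <# F n) (F n))) \<le> e * real (card (F n))"
    using K
    by (intro eventually_happens'[OF sequentially_bot] folner_sequence_eventually_invariant[OF F])
       simp_all
  then obtain n where
    n: "\<And>f. f \<in> K \<Longrightarrow> real (card (sym_diff (f <# F n) (F n))) \<le> e * real (card (F n))"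
    by blast
  note Fn = folner_sequenceD[OF F, of n]
  obtain s where s: "s \<in> carrier G" "c * real (card (F n)) < real (card (D \<inter> (F n #> s)))"
    using Dd Fn unfolding translate_dense_def by blast
  define X where "X = F n #> s"
  have X: "finite X" "X \<noteq> {}" "X \<subseteq> carrier G"
    using Fn s by (auto simp: X_def r_coset_def)
  have inj_s: "inj_on (\<lambda>x. x \<otimes> s) (carrier G)"
    using s by (auto simp: inj_on_def)
  have X_image: "X = (\<lambda>x. x \<otimes> s) ` F n"
    by (auto simp: X_def r_coset_def)
  have cardX: "card X = card (F n)"
    using inj_on_subset[OF inj_s Fn(3)] by (simp add: X_image card_image)
  have X_inv: "real (card (sym_diff (f <# X) X)) \<le> e * real (card X)" if "f \<in> K" for f
  proof -
    have f: "f \<in> carrier G" using that K by auto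
    have "f <# X = (\<lambda>x. x \<otimes> s) ` (f <# F n)"
      using f s Fn by (force simp: X_image l_coset_def m_assoc subset_iff)
    moreover have sub: "f <# F n \<subseteq> carrier G"
      using f Fn by (simp add: l_coset_subset_G)
    ultimately have "sym_diff (f <# X) X = (\<lambda>x. x \<otimes> s) ` sym_diff (f <# F n) (F n)"
      using Fn inj_on_image_set_diff[OF inj_s, of "f <# F n" "F n"]
        inj_on_image_set_diff[OF inj_s, of "F n" "f <# F n"]
      by (simp add: X_image image_Un Diff_subset_conv le_supI2)
    then have "card (sym_diff (f <# X) X) = card (sym_diff (f <# F n) (F n))"
      using sub Fn by (simp only:) (intro card_image inj_on_subset[OF inj_s], auto)
    then show ?thesis using n[OF that] cardX by simp
  qed
  have invX: "finite (set_inv X)" "set_inv X \<noteq> {}" "set_inv X \<subseteq> carrier G"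
    using X by (auto simp: SET_INV_def)
  have inv_image: "set_inv X = (\<lambda>x. inv x) ` X"
    by (auto simp: SET_INV_def)
  have inj_inv: "inj_on (\<lambda>x. inv x) X"
    using X by (intro inj_onI) (metis inv_inv subsetD)
  obtain t where t: "t \<in> carrier G"
      "b * real (card (set_inv X)) < real (card (B \<inter> (set_inv X #> t)))"
    using Bd invX unfolding translate_dense_def by blast
  define Y where "Y = {x \<in> X. inv x \<otimes> t \<in> B}"
  have "{h \<in> set_inv X. h \<otimes> t \<in> B} = (\<lambda>x. inv x) ` Y"
    by (auto simp: inv_image Y_def)
  then have cardY: "b * real (card X) < real (card Y)"
    using t(2) card_image[OF inj_inv] card_image[OF inj_on_subset[OF inj_inv, of Y]]
    unfolding card_Int_r_coset[OF t(1) invX(3)] by (simp add: inv_image Y_def)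
  have "f \<otimes> t \<in> D <#> B" if f: "f \<in> K" for f
  proof -
    have fG: "f \<in> carrier G" using f K by auto
    define Z where "Z = {x \<in> X. f \<otimes> x \<in> D}"
    have "finite (f <# X)"
      using X by (simp add: l_coset_def)
    from card_Int_le_add_sym_diff[OF X(1) this, of D]
    have "card (D \<inter> X) \<le> card Z + card (sym_diff (f <# X) X)"
      unfolding card_Int_l_coset[OF fG X(3)] Z_def by (simp add: Un_commute)
    then have "(c - e) * real (card X) < real (card Z)"
      using X_inv[OF f] s(2) by (simp add: cardX X_def[symmetric] left_diff_distrib)
    then have "real (card X) < real (card Y) + real (card Z)"
      using cardY by (simp add: e_def algebra_simps)
    moreover have "card (Y \<union> Z) \<le> card X"
      using X by (intro card_mono) (auto simp: Y_def Z_def)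
    ultimately have "Y \<inter> Z \<noteq> {}"
      using card_Un_disjoint[of Y Z] X by (auto simp: Y_def Z_def)
    then obtain x where x: "x \<in> X" "inv x \<otimes> t \<in> B" "f \<otimes> x \<in> D"
      by (auto simp: Y_def Z_def)
    then have xG: "x \<in> carrier G" using X by auto
    then have "x \<otimes> (inv x \<otimes> t) = t"
      using t by (simp flip: m_assoc)
    then have "f \<otimes> t = (f \<otimes> x) \<otimes> (inv x \<otimes> t)"
      using xG fG t by (simp add: m_assoc)
    then show ?thesis using x(2,3) unfolding set_mult_def by blast
  qed
  then show "\<exists>t\<in>carrier G. K #> t \<subseteq> D <#> B"
    using t by (auto simp: r_coset_def)
qed

text \<open>Adjoining the complement of \<open>KC\<close> to \<open>C\<close> makes it syndetic: a point of \<open>KC\<close> is reached from \<open>C\<close>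
  through \<open>K\<close>, any other point through the identity. Inside the thick set \<open>KC\<close> nothing
  was added.\<close>

lemma (in group) piecewise_syndetic_if_thick_translates:
  assumes C: "C \<subseteq> carrier G" and K: "finite K" "K \<subseteq> carrier G" and T: "thick G (K <#> C)"
  shows "piecewise_syndetic G C"
proof -
  define S where "S = C \<union> (carrier G - (K <#> C))"
  have S: "S \<subseteq> carrier G" using C by (auto simp: S_def)
  have "carrier G \<subseteq> insert \<one> K <#> S"
  proof
    fix x assume x: "x \<in> carrier G"
    show "x \<in> insert \<one> K <#> S"
    proof (cases "x \<in> K <#> C")
      case True
      then show ?thesis by (auto simp: set_mult_def S_def)
    next
      case False
      then have "x \<in> S" "x = \<one> \<otimes> x" using x by (auto simp: S_def)
      then show ?thesis by (auto simp: set_mult_def)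
    qed
  qed
  moreover have "insert \<one> K <#> S \<subseteq> carrier G"
    using K S by (intro set_mult_closed) auto
  ultimately have "syndetic G S"
    unfolding syndetic_def using S K by (intro conjI exI[of _ "insert \<one> K"]) auto
  moreover have "S \<inter> (K <#> C) \<subseteq> C" by (auto simp: S_def)
  ultimately show ?thesis
    unfolding piecewise_syndetic_def using C T by blast
qed

theorem theorem2:
  fixes G :: "('a, 'b) monoid_scheme" (structure)
    and A B :: "'a set"
  assumes "group G"
    and "countable (carrier G)"
    and "amenable G"
    and "A \<subseteq> carrier G" and "B \<subseteq> carrier G"
    and "upper_banach_density G A > 0"
    and "upper_banach_density G B > 0"
  shows "piecewise_syndetic G (A <#>\<^bsub>G\<^esub> B)"
proof -
  interpret group G by fact
  obtain b where b: "0 < ereal b" "ereal b < upper_banach_density G B"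
    using assms(7) ereal_dense2 by blast
  have "b < 1"
    using b(2) upper_banach_density_le_one[of G B] by (metis ereal_less(3) less_le_trans)
  \<comment> \<open>The threshold \<open>1 - b / 2\<close> is below 1, and its sum with \<open>b\<close> still exceeds 1.\<close>
  then obtain K where K: "finite K" "K \<subseteq> carrier G" "translate_dense G (1 - b / 2) (K <#> A)"
    using translate_dense_finite_translates[OF assms(4,6), of "1 - b / 2"] b(1) by auto
  have "translate_dense G b B"
    using b by (intro translate_dense_of_upper_banach_density assms(5)) auto
  then have "thick G ((K <#> A) <#> B)"
    using b K(2) assms(3-5)
    by (intro thick_set_mult[OF _ _ _ K(3)] set_mult_closed) auto
  then have "thick G (K <#> (A <#> B))"
    using K assms by (simp add: set_mult_assoc)
  then show ?thesis
    using K assms by (intro piecewise_syndetic_if_thick_translates[OF _ K(1,2)] set_mult_closed)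
qed

end
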